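(* Let $k,m,n$ be positive integers with $k-1\ge m(n-1)$, and let $F$ be a field with $\mathrm{ch}(F)>\max\{mn,\,(k-1-m(n-1))n\}$. Assume that $c_1,\ldots,c_n\in F$ are distinct, and that $A_1,\ldots,A_n,B_1,\ldots,B_n$ are subsets of $F$ with $|A_1|=\cdots=|A_n|=k$ and $|B_1|=\cdots=|B_n|=n$. Let $S_{ij}\subseteq F$ with $|S_{ij}|<2m$ for all $1\le i<j\le n$. Then there is a system of distinct representatives $\{b_i\}_{i=1}^n$ of $\{B_i\}_{i=1}^n$ such that the restricted sumset $$S=\{a_1+\cdots+a_n:\ a_i\in A_i \text{ for } 1\le i\le n,\ \text{and } a_i-a_j\notin S_{ij},\ a_ib_ic_i\ne a_jb_jc_j \text{ whenever } 1\le i<j\le n\}$$ has at least $(k-1-m(n-1))n+1$ elements.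
   Context: For a field $F$, $\mathrm{ch}(F)$ denotes the additive order of the multiplicative identity of $F$; it is either a prime or infinite (so $\mathrm{ch}(F)=+\infty$ for fields of characteristic zero in the usual sense). A system of distinct representatives (SDR) of a finite sequence of sets $\{B_i\}_{i=1}^n$ is a sequence $\{b_i\}_{i=1}^n$ with $b_i\in B_i$ for all $i$ and $b_1,\ldots,b_n$ pairwise distinct. *)

theory Defs
  imports Main "HOL-Library.Extended_Nat"
begin

text \<open>
  The library's \<open>CHAR('a)\<close> is \<open>0\<close> when no positive multiple of \<open>1\<close> vanishes; here the
  characteristic is the additive order of \<open>1\<close>, so it is infinite in that case.
\<close>

definition ch :: "'a::field itself \<Rightarrow> enat" where
  "ch _ = (if CHAR('a) = 0 then \<infinity> else enat CHAR('a))"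

lemma ch_additive_order:
  "ch TYPE('a::field) = (INF n \<in> {n. 0 < n \<and> of_nat n = (0::'a)}. enat n)"
proof (cases "CHAR('a) = 0")
  case True
  then have empty: "{n. 0 < n \<and> of_nat n = (0::'a)} = {}"
    by (auto simp: CHAR_eq0_iff)
  show ?thesis
    unfolding empty using True by (simp add: ch_def top_enat_def)
next
  case False
  have "(INF n \<in> {n. 0 < n \<and> of_nat n = (0::'a)}. enat n) = enat CHAR('a)"
  proof (rule antisym)
    show "(INF n \<in> {n. 0 < n \<and> of_nat n = (0::'a)}. enat n) \<le> enat CHAR('a)"
      using False by (intro INF_lower) simp
    show "enat CHAR('a) \<le> (INF n \<in> {n. 0 < n \<and> of_nat n = (0::'a)}. enat n)"
      by (intro INF_greatest) (auto simp: of_nat_eq_0_iff_char_dvd dvd_imp_le)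
  qed
  then show ?thesis
    using False by (simp add: ch_def)
qed

definition is_SDR :: "nat \<Rightarrow> (nat \<Rightarrow> 'a set) \<Rightarrow> (nat \<Rightarrow> 'a) \<Rightarrow> bool" where
  "is_SDR n B b \<longleftrightarrow> (\<forall>i\<in>{1..n}. b i \<in> B i) \<and> inj_on b {1..n}"

end

theory Submission
  imports Defs "HOL-Library.FuncSet" "Jordan_Normal_Form.Determinant"
begin

text \<open>
  A product of \<open>\<Sum>i<n. e i\<close> affine forms, weighted by Lagrange interpolation weights and summed
  over a grid whose sides have \<open>e i + 1\<close> points, yields the coefficient of the monomial with
  exponents \<open>e i\<close> in the product of the linear parts. It depends neither on the grid nor on the
  constant terms.

  If there were at most \<open>l * n\<close> sums, where \<open>l = k - 1 - m * (n - 1)\<close>, then a product of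
  forms \<open>(\<Sum>i<n. a i) - w\<close>, \<open>a j - a i - z\<close> and \<open>y j * a j - y i * a i\<close>, with \<open>y i = b i * c i\<close>,
  would vanish on the whole grid of the \<open>A i\<close>. By antisymmetry its coefficient is the permanent
  of the matrix of powers of \<open>y\<close> times a constant \<open>C\<close>. The same summation over the grid of the
  \<open>B i\<close> turns this permanent, multiplied by the Vandermonde product in \<open>b\<close>, into the nonzero
  Vandermonde product in \<open>c\<close> up to sign, so some system of distinct representatives has a nonzero
  permanent. For \<open>y = 1\<close> the coefficient is an integer; over the rationals, on the grid
  \<open>{0..k - 1}\<close> and with suitable constant terms, the product survives only at
  \<open>a i = m * i\<close>, where its value has no prime factor exceeding both \<open>m * n\<close> and \<open>l * n\<close>.
  Hence \<open>C\<close> is nonzero.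
\<close>

subsection \<open>Coefficients by summation over a grid\<close>

text \<open>For \<open>a\<close> in a finite \<open>A\<close> this is the reciprocal of the
  derivative of the node polynomial of \<open>A\<close> at \<open>a\<close>. Summing f a against it
  over \<open>A\<close> gives the divided difference of f.\<close>

definition lagrange_weight :: "'a::field set \<Rightarrow> 'a \<Rightarrow> 'a" where
  "lagrange_weight A a = (\<Prod>b\<in>A - {a}. inverse (a - b))"

lemma lagrange_weight_remove:
  assumes "finite A" "a \<in> A" "b \<in> A" "a \<noteq> b"
  shows "(a - b) * lagrange_weight A a = lagrange_weight (A - {b}) a"
proof -
  have "A - {a} = insert b (A - {b} - {a})"
    using assms by auto
  then show ?thesis
    unfolding lagrange_weight_def using assms by simp
qed

text \<open>Split one factor \<open>a\<close> as b + (a - b): the factor a - b kills the node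
  \<open>b\<close> and cancels against the weights of all other nodes.\<close>

lemma lagrange_moment_Suc:
  assumes "finite A" "b \<in> A"
  shows "(\<Sum>a\<in>A. a ^ Suc d * lagrange_weight A a) =
    b * (\<Sum>a\<in>A. a ^ d * lagrange_weight A a) +
    (\<Sum>a\<in>A - {b}. a ^ d * lagrange_weight (A - {b}) a)"
proof -
  have "(\<Sum>a\<in>A. a ^ Suc d * lagrange_weight A a) - b * (\<Sum>a\<in>A. a ^ d * lagrange_weight A a)
      = (\<Sum>a\<in>A. a ^ d * ((a - b) * lagrange_weight A a))"
    by (simp add: sum_distrib_left sum_subtractf algebra_simps)
  also have "\<dots> = (\<Sum>a\<in>A - {b}. a ^ d * ((a - b) * lagrange_weight A a))"
    using assms by (simp add: sum.remove[of A b])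
  also have "\<dots> = (\<Sum>a\<in>A - {b}. a ^ d * lagrange_weight (A - {b}) a)"
    using assms by (intro sum.cong) (auto simp: lagrange_weight_remove)
  finally show ?thesis
    by (simp add: algebra_simps)
qed

text \<open>The recursion at two distinct nodes b and c computes the same first moment. By induction
  the sums over \<open>A - {b}\<close> and \<open>A - {c}\<close> agree, so (b - c) times the zeroth
  moment is 0.\<close>

lemma lagrange_moment_0:
  assumes "finite A" "A \<noteq> {}"
  shows "(\<Sum>a\<in>A. lagrange_weight A a) = (if card A = 1 then 1 else 0)"
  using assms
proof (induction "card A" arbitrary: A rule: less_induct)
  case less
  show ?case
  proof (cases "card A = 1")
    case True
    then show ?thesis
      by (auto simp: card_1_singleton_iff lagrange_weight_def)
  next
    case False
    then have "2 \<le> card A"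
      using less.prems by (metis One_nat_def Suc_leI card_gt_0_iff le_neq_implies_less numeral_2_eq_2)
    then obtain b c where bc: "b \<in> A" "c \<in> A" "b \<noteq> c"
      by (metis obtain_subset_with_card_n card_2_iff insert_subset)
    have *: "(\<Sum>a\<in>A - {x}. lagrange_weight (A - {x}) a) = (if card A = 2 then 1 else 0)"
      if "x \<in> A" for x
    proof -
      have card: "card (A - {x}) = card A - 1"
        using that by (rule card_Diff_singleton)
      then have "card (A - {x}) \<noteq> 0"
        using \<open>2 \<le> card A\<close> by simp
      then have "A - {x} \<noteq> {}"
        by (metis card.empty)
      then have "(\<Sum>a\<in>A - {x}. lagrange_weight (A - {x}) a) = (if card (A - {x}) = 1 then 1 else 0)"
        using less.hyps[of "A - {x}"] less.prems card \<open>2 \<le> card A\<close> by simp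
      then show ?thesis
        using card \<open>2 \<le> card A\<close> by auto
    qed
    have "(b - c) * (\<Sum>a\<in>A. lagrange_weight A a) = 0"
      using lagrange_moment_Suc[OF less.prems(1) bc(1), of 0]
        lagrange_moment_Suc[OF less.prems(1) bc(2), of 0] *[OF bc(1)] *[OF bc(2)]
      by (simp add: algebra_simps)
    then show ?thesis
      using False bc by simp
  qed
qed

text \<open>Deleting a node lowers degree and cardinality together; the other term of the recursion
  is a moment of degree strictly below card A - 1, hence 0.\<close>

lemma lagrange_moment:
  assumes "finite A" "d < card A"
  shows "(\<Sum>a\<in>A. a ^ d * lagrange_weight A a) = (if Suc d = card A then 1 else 0)"
  using assms
proof (induction d arbitrary: A)
  case 0
  then show ?case
    using lagrange_moment_0[of A] by (cases "A = {}") auto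
next
  case (Suc d)
  then obtain b where b: "b \<in> A"
    by fastforce
  have "(\<Sum>a\<in>A. a ^ d * lagrange_weight A a) = 0"
    using Suc.IH[of A] Suc.prems by auto
  moreover have "(\<Sum>a\<in>A - {b}. a ^ d * lagrange_weight (A - {b}) a) =
      (if Suc d = card (A - {b}) then 1 else 0)"
    using Suc.IH[of "A - {b}"] Suc.prems b by (auto simp: card_Diff_singleton)
  ultimately show ?case
    using Suc.prems unfolding lagrange_moment_Suc[OF Suc.prems(1) b]
    by (auto simp: card_Diff_singleton[OF b])
qed

section \<open>Weighted sums over product grids\<close>

definition grid_functional :: "nat \<Rightarrow> (nat \<Rightarrow> 'a set) \<Rightarrow> ((nat \<Rightarrow> 'a) \<Rightarrow> 'a) \<Rightarrow> 'a::field" where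
  "grid_functional n A f = (\<Sum>a\<in>PiE {..<n} A. f a * (\<Prod>i<n. lagrange_weight (A i) (a i)))"

lemma grid_functional_sum:
  "grid_functional n A (\<lambda>a. \<Sum>g\<in>G. f g a) = (\<Sum>g\<in>G. grid_functional n A (f g))"
  unfolding grid_functional_def by (subst sum.swap) (simp add: sum_distrib_right)

lemma grid_functional_cmult:
  "grid_functional n A (\<lambda>a. c * f a) = c * grid_functional n A f"
  unfolding grid_functional_def by (simp add: sum_distrib_left mult_ac)

lemma grid_functional_nonzeroE:
  assumes "grid_functional n A f \<noteq> 0"
  obtains a where "a \<in> PiE {..<n} A" "f a \<noteq> 0"
  using assms unfolding grid_functional_def by (metis (no_types, lifting) mult_zero_left sum.neutral)

text \<open>The sum factors into one-variable moments. Under the bound on the total degree, any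
  other exponent vector has some d i < e i, whose moment vanishes; exponents above e i then do no
  harm.\<close>

lemma grid_functional_monomial:
  assumes card: "\<And>i. i < n \<Longrightarrow> card (A i) = Suc (e i)"
    and le: "(\<Sum>i<n. d i) \<le> (\<Sum>i<n. e i)"
  shows "grid_functional n A (\<lambda>a. \<Prod>i<n. a i ^ d i) = (if \<forall>i<n. d i = e i then 1 else 0)"
proof -
  have fin: "finite (A i)" if "i < n" for i
    using card[OF that] by (metis card.infinite nat.distinct(1))
  have "grid_functional n A (\<lambda>a. \<Prod>i<n. a i ^ d i) =
      (\<Prod>i<n. \<Sum>x\<in>A i. x ^ d i * lagrange_weight (A i) x)"
    unfolding grid_functional_def
    by (subst prod_sum_PiE) (auto simp: fin prod.distrib)
  also have "\<dots> = (if \<forall>i<n. d i = e i then 1 else 0)"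
  proof (cases "\<forall>i<n. d i = e i")
    case True
    then show ?thesis
      by (auto simp: lagrange_moment fin card)
  next
    case False
    have "\<exists>i<n. d i < e i"
    proof (rule ccontr)
      assume "\<not> (\<exists>i<n. d i < e i)"
      then have ge: "\<forall>i<n. e i \<le> d i"
        by auto
      with False have "(\<Sum>i<n. e i) < (\<Sum>i<n. d i)"
        by (intro sum_strict_mono_ex1) (auto simp: order_le_less)
      with le show False
        by simp
    qed
    then obtain i where "i < n" "d i < e i"
      by auto
    then have "\<exists>i\<in>{..<n}. (\<Sum>x\<in>A i. x ^ d i * lagrange_weight (A i) x) = 0"
      by (intro bexI[of _ i]) (auto simp: lagrange_moment fin card)
    then show ?thesis
      unfolding if_not_P[OF False] by (intro prod_zero) auto
  qed
  finally show ?thesis .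
qed

text \<open>The coefficient of the monomial with exponents \<open>e\<close>: \<open>g\<close>
  chooses the variable taken from each form. Stated over commutative rings, it can be computed over
  the integers and mapped into a field.\<close>

definition linear_forms_coeff ::
    "nat \<Rightarrow> 't set \<Rightarrow> (nat \<Rightarrow> nat) \<Rightarrow> ('t \<Rightarrow> nat \<Rightarrow> 'a) \<Rightarrow> 'a::comm_ring_1" where
  "linear_forms_coeff n T e \<alpha> =
    (\<Sum>g\<in>{g \<in> T \<rightarrow>\<^sub>E {..<n}. \<forall>i<n. card {t\<in>T. g t = i} = e i}. \<Prod>t\<in>T. \<alpha> t (g t))"

lemma linear_forms_coeff_of_int:
  "linear_forms_coeff n T e (\<lambda>t i. of_int (\<alpha> t i)) = of_int (linear_forms_coeff n T e \<alpha>)"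
  unfolding linear_forms_coeff_def by simp

text \<open>A coefficient formula in the style of the Combinatorial Nullstellensatz. Choosing a
  constant term when expanding lowers the total degree, so such terms contribute nothing.\<close>

lemma grid_functional_prod_linear:
  fixes A :: "nat \<Rightarrow> 'a::field set"
  assumes T: "finite T" "card T = (\<Sum>i<n. e i)"
    and card: "\<And>i. i < n \<Longrightarrow> card (A i) = Suc (e i)"
  shows "grid_functional n A (\<lambda>a. \<Prod>t\<in>T. (\<Sum>i<n. \<alpha> t i * a i) - \<beta> t) = linear_forms_coeff n T e \<alpha>"
proof -
  \<comment> \<open>Index \<open>n\<close> stands for a dummy variable of value 1 carrying the
    constant term.\<close>
  define \<gamma> where "\<gamma> t i = (if i = n then - \<beta> t else \<alpha> t i)" for t i
  define d where "d g i = card {t\<in>T. g t = i}" for g :: "_ \<Rightarrow> nat" and i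
  let ?G = "T \<rightarrow>\<^sub>E {..n}"
  have expand: "(\<Prod>t\<in>T. (\<Sum>i<n. \<alpha> t i * a i) - \<beta> t) =
      (\<Sum>g\<in>?G. (\<Prod>t\<in>T. \<gamma> t (g t)) * (\<Prod>i<n. a i ^ d g i))" for a
  proof -
    have "(\<Prod>t\<in>T. (\<Sum>i<n. \<alpha> t i * a i) - \<beta> t) =
        (\<Prod>t\<in>T. \<Sum>i\<in>{..n}. \<gamma> t i * (if i = n then 1 else a i))"
      by (intro prod.cong refl) (simp add: \<gamma>_def lessThan_Suc_atMost[symmetric])
    also have "\<dots> = (\<Sum>g\<in>?G. \<Prod>t\<in>T. \<gamma> t (g t) * (if g t = n then 1 else a (g t)))"
      using T by (subst prod_sum_PiE) auto
    also have "\<dots> = (\<Sum>g\<in>?G. (\<Prod>t\<in>T. \<gamma> t (g t)) * (\<Prod>i<n. a i ^ d g i))"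
    proof (intro sum.cong refl)
      fix g assume g: "g \<in> ?G"
      have "(\<Prod>t\<in>T. if g t = n then 1 else a (g t)) =
          (\<Prod>i\<in>{..n}. \<Prod>t\<in>{t\<in>T. g t = i}. if g t = n then 1 else a (g t))"
        using g T by (intro prod.group[symmetric]) auto
      also have "\<dots> = (\<Prod>i\<in>{..n}. if i = n then 1 else a i ^ d g i)"
        by (intro prod.cong refl) (auto simp: d_def)
      also have "\<dots> = (\<Prod>i<n. a i ^ d g i)"
        by (simp add: lessThan_Suc_atMost[symmetric])
      finally show "(\<Prod>t\<in>T. \<gamma> t (g t) * (if g t = n then 1 else a (g t))) =
          (\<Prod>t\<in>T. \<gamma> t (g t)) * (\<Prod>i<n. a i ^ d g i)"
        by (simp add: prod.distrib)
    qed
    finally show ?thesis .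
  qed
  have card_T: "card T = (\<Sum>i<n. d g i) + d g n" if "g \<in> ?G" for g
  proof -
    have "card T = (\<Sum>i\<in>{..n}. \<Sum>t\<in>{t\<in>T. g t = i}. 1)"
      using that T by (subst sum.group) auto
    then show ?thesis
      by (simp add: d_def lessThan_Suc_atMost[symmetric])
  qed
  have "grid_functional n A (\<lambda>a. \<Prod>t\<in>T. (\<Sum>i<n. \<alpha> t i * a i) - \<beta> t) =
      (\<Sum>g\<in>?G. (\<Prod>t\<in>T. \<gamma> t (g t)) * grid_functional n A (\<lambda>a. \<Prod>i<n. a i ^ d g i))"
    unfolding expand by (simp add: grid_functional_sum grid_functional_cmult)
  also have "\<dots> = (\<Sum>g\<in>?G. if \<forall>i<n. d g i = e i then \<Prod>t\<in>T. \<gamma> t (g t) else 0)"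
  proof (intro sum.cong refl)
    fix g assume "g \<in> ?G"
    then have "(\<Sum>i<n. d g i) \<le> (\<Sum>i<n. e i)"
      using card_T[of g] T by simp
    then show "(\<Prod>t\<in>T. \<gamma> t (g t)) * grid_functional n A (\<lambda>a. \<Prod>i<n. a i ^ d g i) =
        (if \<forall>i<n. d g i = e i then \<Prod>t\<in>T. \<gamma> t (g t) else 0)"
      by (subst grid_functional_monomial[OF card]) auto
  qed
  also have "\<dots> = (\<Sum>g\<in>{g\<in>?G. \<forall>i<n. d g i = e i}. \<Prod>t\<in>T. \<gamma> t (g t))"
    using T by (intro sum.mono_neutral_cong_right) (auto intro!: finite_PiE)
  also have "\<dots> = linear_forms_coeff n T e \<alpha>"
    unfolding linear_forms_coeff_def
  proof (intro sum.cong)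
    show eq: "{g\<in>?G. \<forall>i<n. d g i = e i} =
        {g \<in> T \<rightarrow>\<^sub>E {..<n}. \<forall>i<n. card {t\<in>T. g t = i} = e i}"
    proof (rule Set.set_eqI, rule iffI)
      fix g assume "g \<in> {g\<in>?G. \<forall>i<n. d g i = e i}"
      then have g: "g \<in> ?G" "\<forall>i<n. d g i = e i"
        by auto
      \<comment> \<open>The exponents \<open>e i\<close> already account for every form in
        \<open>T\<close>.\<close>
      then have "d g n = 0"
        using card_T[of g] T by simp
      then have "\<forall>t\<in>T. g t \<noteq> n"
        using T by (auto simp: d_def)
      then have "g \<in> T \<rightarrow>\<^sub>E {..<n}"
        using g by (fastforce simp: PiE_iff order_le_less)
      then show "g \<in> {g \<in> T \<rightarrow>\<^sub>E {..<n}. \<forall>i<n. card {t\<in>T. g t = i} = e i}"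
        using g by (simp add: d_def)
    next
      fix g assume "g \<in> {g \<in> T \<rightarrow>\<^sub>E {..<n}. \<forall>i<n. card {t\<in>T. g t = i} = e i}"
      then show "g \<in> {g\<in>?G. \<forall>i<n. d g i = e i}"
        by (auto simp: d_def PiE_iff less_imp_le)
    qed
    fix g assume "g \<in> {g \<in> T \<rightarrow>\<^sub>E {..<n}. \<forall>i<n. card {t\<in>T. g t = i} = e i}"
    then show "(\<Prod>t\<in>T. \<gamma> t (g t)) = (\<Prod>t\<in>T. \<alpha> t (g t))"
      by (intro prod.cong) (auto simp: \<gamma>_def PiE_iff)
  qed
  finally show ?thesis .
qed

subsection \<open>Vandermonde products and permanents\<close>

definition vandermonde :: "nat \<Rightarrow> (nat \<Rightarrow> 'a) \<Rightarrow> 'a::comm_ring_1" where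
  "vandermonde n x = (\<Prod>j<n. \<Prod>i<j. x j - x i)"

lemma vandermonde_eq_0_iff:
  fixes x :: "nat \<Rightarrow> 'a::idom"
  shows "vandermonde n x = 0 \<longleftrightarrow> \<not> inj_on x {..<n}"
proof -
  have "vandermonde n x = 0 \<longleftrightarrow> (\<exists>j<n. \<exists>i<j. x j = x i)"
    by (auto simp: vandermonde_def)
  also have "\<dots> \<longleftrightarrow> \<not> inj_on x {..<n}"
  proof
    assume "\<exists>j<n. \<exists>i<j. x j = x i"
    then obtain i j where "i < j" "j < n" "x j = x i"
      by blast
    then show "\<not> inj_on x {..<n}"
      by (auto dest: inj_onD[of x _ j i])
  next
    assume "\<not> inj_on x {..<n}"
    then obtain i j where "i < n" "j < n" "x j = x i" "i \<noteq> j"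
      by (auto simp: inj_on_def)
    then show "\<exists>j<n. \<exists>i<j. x j = x i"
      by (cases i j rule: linorder_cases) force+
  qed
  finally show ?thesis .
qed

text \<open>Replace the last row by powers of a variable t. The determinant becomes a polynomial in
  t of degree at most \<open>n\<close> that vanishes at the earlier nodes and has the smaller
  determinant as its coefficient of degree \<open>n\<close>. If earlier nodes coincide, both sides
  are 0.\<close>

lemma det_vandermonde:
  fixes x :: "nat \<Rightarrow> 'a::field"
  shows "det (mat n n (\<lambda>(i, j). x i ^ j)) = vandermonde n x"
proof (induction n)
  case 0
  show ?case
    by (simp add: vandermonde_def)
next
  case (Suc n)
  define M where "M t = mat (Suc n) (Suc n) (\<lambda>(i, j). (if i = n then t else x i) ^ j)" for t
  define c where "c j = cofactor (M 0) n j" for j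
  have M_carrier: "M t \<in> carrier_mat (Suc n) (Suc n)" for t
    by (simp add: M_def)
  \<comment> \<open>Only row \<open>n\<close> depends on \<open>t\<close>, so the cofactors along it
    are constants.\<close>
  have "mat_delete (M t) n j = mat_delete (M 0) n j" for t j
    by (rule eq_matI) (auto simp: mat_delete_def M_def)
  then have "cofactor (M t) n j = c j" for t j
    unfolding c_def cofactor_def by metis
  then have det_M: "det (M t) = (\<Sum>j<Suc n. t ^ j * c j)" for t
    using laplace_expansion_row[OF M_carrier, of n t]
    by (simp add: M_def)
  have "mat_delete (M 0) n n = mat n n (\<lambda>(i, j). x i ^ j)"
    by (rule eq_matI) (auto simp: mat_delete_def M_def)
  then have c_n: "c n = vandermonde n x"
    using Suc.IH by (simp add: c_def cofactor_def flip: mult_2)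
  have M_x: "M (x n) = mat (Suc n) (Suc n) (\<lambda>(i, j). x i ^ j)"
    unfolding M_def by (rule eq_matI) auto
  show ?case
  proof (cases "inj_on x {..<n}")
    case False
    then obtain i i' where i: "i < n" "i' < n" "i \<noteq> i'" "x i = x i'"
      by (auto simp: inj_on_def)
    then have "row (M (x n)) i = row (M (x n)) i'"
      by (intro eq_vecI) (auto simp: M_def)
    then have "det (M (x n)) = 0"
      using det_identical_rows[OF M_carrier] i by (metis less_SucI)
    moreover have "\<not> inj_on x {..<Suc n}"
      using False by (meson inj_on_subset lessThan_subset_iff lessI less_imp_le)
    ultimately show ?thesis
      by (simp add: M_x vandermonde_eq_0_iff)
  next
    case True
    define p where "p = (\<Sum>j<Suc n. monom (c j) j)"
    define r where "r = (\<Prod>i<n. [:- x i, 1:])"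
    have poly_p: "poly p t = det (M t)" for t
      unfolding det_M p_def by (simp add: poly_sum poly_monom mult.commute)
    have poly_r: "poly r t = (\<Prod>i<n. t - x i)" for t
      unfolding r_def by (simp add: poly_prod)
    have deg_r: "degree r = n"
      unfolding r_def by (subst degree_prod_eq_sum_degree) auto
    have lead_r: "lead_coeff r = 1"
      unfolding r_def by (simp add: lead_coeff_prod)
    \<comment> \<open>The terms of degree \<open>n\<close> cancel, while the \<open>n\<close>
      distinct nodes are roots; hence \<open>q\<close> is 0.\<close>
    define q where "q = p - smult (c n) r"
    have "degree p \<le> n"
      unfolding p_def by (intro degree_sum_le) (auto intro: order_trans[OF degree_monom_le])
    then have "degree q \<le> n"
      unfolding q_def using deg_r
      by (intro degree_diff_le) (auto intro: order_trans[OF degree_smult_le])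
    moreover have "coeff q n = 0"
      unfolding q_def using deg_r lead_r by (simp add: p_def coeff_sum)
    ultimately have deg_q: "q = 0 \<or> degree q < n"
      by (metis leading_coeff_0_iff order_le_less)
    have "x ` {..<n} \<subseteq> {t. poly q t = 0}"
    proof clarify
      fix i assume "i < n"
      then have "row (M (x i)) i = row (M (x i)) n"
        by (intro eq_vecI) (auto simp: M_def)
      then have "det (M (x i)) = 0"
        using det_identical_rows[OF M_carrier, of i n] \<open>i < n\<close> by simp
      moreover have "poly r (x i) = 0"
        unfolding poly_r using \<open>i < n\<close> by (auto simp: prod_zero_iff)
      ultimately show "poly q (x i) = 0"
        by (simp add: q_def poly_p)
    qed
    then have "q = 0"
      using deg_q card_poly_roots_bound[of q] poly_roots_finite[of q] card_image[OF True]
      by (metis card_lessThan card_mono leD le_trans)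
    then have "det (M (x n)) = c n * (\<Prod>i<n. x n - x i)"
      using poly_p[of "x n"] poly_r[of "x n"] by (simp add: q_def)
    then show ?thesis
      by (simp add: M_x c_n vandermonde_def)
  qed
qed

lemma vandermonde_Leibniz:
  fixes x :: "nat \<Rightarrow> 'a::field"
  shows "vandermonde n x =
    (\<Sum>\<sigma> | \<sigma> permutes {..<n}. of_int (sign \<sigma>) * (\<Prod>j<n. x j ^ \<sigma> j))"
proof -
  have "det (mat n n (\<lambda>(i, j). x i ^ j)) =
      (\<Sum>\<sigma> | \<sigma> permutes {0..<n}. of_int (sign \<sigma>) * (\<Prod>j = 0..<n. x j ^ \<sigma> j))"
    by (subst det_def'[of _ n]) (auto intro!: sum.cong prod.cong simp: permutes_in_image)
  then show ?thesis
    by (simp add: det_vandermonde lessThan_atLeast0)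
qed

lemma vandermonde_permute:
  fixes x :: "nat \<Rightarrow> 'a::field"
  assumes "\<tau> permutes {..<n}"
  shows "vandermonde n (x \<circ> \<tau>) = of_int (sign \<tau>) * vandermonde n x"
proof -
  have "mat n n (\<lambda>(i, j). mat n n (\<lambda>(i, j). x i ^ j) $$ (\<tau> i, j)) = mat n n (\<lambda>(i, j). (x \<circ> \<tau>) i ^ j)"
    using permutes_in_image[OF assms] by (intro eq_matI) auto
  then show ?thesis
    using det_permute_rows[of "mat n n (\<lambda>(i, j). x i ^ j)" n \<tau>] assms
    by (simp add: det_vandermonde lessThan_atLeast0 comp_def)
qed

text \<open>All sides of the grid are the same set, so relabelling the variables preserves both the
  grid and the weights.\<close>

lemma grid_functional_permute:
  assumes \<tau>: "\<tau> permutes {..<n}"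
  shows "grid_functional n (\<lambda>_. A) (\<lambda>a. f (a \<circ> \<tau>)) = grid_functional n (\<lambda>_. A) f"
proof -
  have "grid_functional n (\<lambda>_. A) (\<lambda>a. f (a \<circ> \<tau>)) =
      (\<Sum>a\<in>{..<n} \<rightarrow>\<^sub>E A. f (a \<circ> \<tau>) * (\<Prod>i<n. lagrange_weight A ((a \<circ> \<tau>) i)))"
    unfolding grid_functional_def comp_def
    by (intro sum.cong arg_cong2[where f = "(*)"] refl)
      (rule prod.reindex_bij_betw[OF permutes_imp_bij[OF \<tau>], symmetric])
  also have "\<dots> = grid_functional n (\<lambda>_. A) f"
    unfolding grid_functional_def
  proof (rule sum.reindex_bij_witness[of _ "\<lambda>a. a \<circ> Hilbert_Choice.inv \<tau>" "\<lambda>a. a \<circ> \<tau>"])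
    have mem: "a \<circ> \<rho> \<in> {..<n} \<rightarrow>\<^sub>E A" if "a \<in> {..<n} \<rightarrow>\<^sub>E A" "\<rho> permutes {..<n}" for a \<rho>
      using that permutes_in_image[OF that(2)]
      by (auto simp: PiE_iff extensional_def)
    show "a \<circ> \<tau> \<in> {..<n} \<rightarrow>\<^sub>E A" "a \<circ> Hilbert_Choice.inv \<tau> \<in> {..<n} \<rightarrow>\<^sub>E A" if "a \<in> {..<n} \<rightarrow>\<^sub>E A" for a
      using mem that \<tau> permutes_inv by blast+
  qed (simp_all add: comp_assoc permutes_inv_o[OF \<tau>])
  finally show ?thesis .
qed

definition power_permanent :: "nat \<Rightarrow> (nat \<Rightarrow> 'a) \<Rightarrow> 'a::comm_ring_1" where
  "power_permanent n y = (\<Sum>\<sigma> | \<sigma> permutes {..<n}. \<Prod>j<n. y j ^ \<sigma> j)"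

lemma of_int_sign_mult_self: "of_int (sign \<sigma>) * (of_int (sign \<sigma>) * z) = (z :: 'a::comm_ring_1)"
  by (simp flip: mult.assoc of_int_mult)

text \<open>In the Leibniz expansion, relabelling by \<sigma> turns the monomial with exponents
  \<sigma> j into the one with exponents j. The antisymmetric \<open>P\<close> contributes a sign
  that cancels the Leibniz sign, which leaves a permanent in \<open>y\<close>.\<close>

lemma grid_functional_vandermonde_twist:
  fixes A :: "'a::field set"
  assumes P: "\<And>\<tau> a. \<tau> permutes {..<n} \<Longrightarrow> P (a \<circ> \<tau>) = of_int (sign \<tau>) * P a"
  shows "grid_functional n (\<lambda>_. A) (\<lambda>a. P a * vandermonde n (\<lambda>j. y j * a j)) =
    power_permanent n y * grid_functional n (\<lambda>_. A) (\<lambda>a. P a * (\<Prod>j<n. a j ^ j))"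
proof -
  let ?L = "grid_functional n (\<lambda>_. A)"
  have L_perm: "?L (\<lambda>a. P a * (\<Prod>j<n. a j ^ \<sigma> j)) =
      of_int (sign \<sigma>) * ?L (\<lambda>a. P a * (\<Prod>j<n. a j ^ j))" if \<sigma>: "\<sigma> permutes {..<n}" for \<sigma>
  proof -
    have prod: "(\<Prod>j<n. (a \<circ> \<sigma>) j ^ \<sigma> j) = (\<Prod>j<n. a j ^ j)" for a :: "nat \<Rightarrow> 'a"
      using prod.reindex_bij_betw[OF permutes_imp_bij[OF \<sigma>], of "\<lambda>j. a j ^ j"] by simp
    have "?L (\<lambda>a. P a * (\<Prod>j<n. a j ^ \<sigma> j)) = ?L (\<lambda>a. P (a \<circ> \<sigma>) * (\<Prod>j<n. (a \<circ> \<sigma>) j ^ \<sigma> j))"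
      by (rule grid_functional_permute[OF \<sigma>, symmetric])
    also have "\<dots> = ?L (\<lambda>a. of_int (sign \<sigma>) * (P a * (\<Prod>j<n. a j ^ j)))"
      unfolding prod P[OF \<sigma>] by (simp only: mult.assoc)
    finally show ?thesis
      by (simp only: grid_functional_cmult)
  qed
  have "?L (\<lambda>a. P a * vandermonde n (\<lambda>j. y j * a j)) =
      (\<Sum>\<sigma> | \<sigma> permutes {..<n}. (of_int (sign \<sigma>) * (\<Prod>j<n. y j ^ \<sigma> j)) *
        ?L (\<lambda>a. P a * (\<Prod>j<n. a j ^ \<sigma> j)))"
    unfolding vandermonde_Leibniz sum_distrib_left grid_functional_sum
    by (intro sum.cong refl)
      (simp add: power_mult_distrib prod.distrib mult_ac flip: grid_functional_cmult)
  also have "\<dots> = (\<Sum>\<sigma> | \<sigma> permutes {..<n}. (\<Prod>j<n. y j ^ \<sigma> j) *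
        ?L (\<lambda>a. P a * (\<Prod>j<n. a j ^ j)))"
    by (intro sum.cong refl) (simp add: L_perm mult_ac of_int_sign_mult_self)
  finally show ?thesis
    by (simp add: power_permanent_def sum_distrib_right)
qed

text \<open>The factor \<open>vandermonde n b\<close> serves twice: its nonvanishing makes the
  representatives distinct, and its Leibniz signs turn the permanent into a determinant in
  \<open>c\<close>.\<close>

lemma exists_SDR_power_permanent:
  fixes c :: "nat \<Rightarrow> 'a::field"
  assumes n: "0 < n" and c: "inj_on c {..<n}" and card: "\<And>i. i < n \<Longrightarrow> card (B i) = n"
  shows "\<exists>b. (\<forall>i<n. b i \<in> B i) \<and> inj_on b {..<n} \<and> power_permanent n (\<lambda>j. b j * c j) \<noteq> 0"
proof -
  let ?S = "{\<sigma>. \<sigma> permutes {..<n}}"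
  \<comment> \<open>Each side has \<open>n\<close> points, so a surviving monomial has exponent n -
    1 in every variable; this forces \<tau> j = n - 1 - \<sigma> j.\<close>
  define \<rho> where "\<rho> j = (if j < n then n - 1 - j else j)" for j
  have \<rho>: "\<rho> permutes {..<n}"
    by (rule bij_imp_permutes, rule bij_betw_byWitness[of _ \<rho>]) (auto simp: \<rho>_def)
  have L_mono: "grid_functional n B (\<lambda>b. \<Prod>j<n. b j ^ (\<tau> j + \<sigma> j)) = (if \<tau> = \<rho> \<circ> \<sigma> then 1 else 0)"
    if \<sigma>: "\<sigma> permutes {..<n}" and \<tau>: "\<tau> permutes {..<n}" for \<sigma> \<tau>
  proof -
    have sum_perm: "(\<Sum>j<n. \<pi> j) = \<Sum>{..<n}" if "\<pi> permutes {..<n}" for \<pi>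
      using sum.reindex_bij_betw[OF permutes_imp_bij[OF that], of "\<lambda>j. j"] by simp
    have "(\<Sum>j<n. \<tau> j + \<sigma> j) = (\<Sum>j<n. \<rho> j) + \<Sum>{..<n}"
      by (simp add: sum.distrib sum_perm \<sigma> \<tau> \<rho>)
    also have "\<dots> = (\<Sum>j<n. n - 1)"
      by (simp add: \<rho>_def flip: sum.distrib)
    finally have le: "(\<Sum>j<n. \<tau> j + \<sigma> j) \<le> (\<Sum>j<n. n - 1)"
      by simp
    have "(\<forall>j<n. \<tau> j + \<sigma> j = n - 1) \<longleftrightarrow> \<tau> = \<rho> \<circ> \<sigma>"
    proof
      assume *: "\<forall>j<n. \<tau> j + \<sigma> j = n - 1"
      show "\<tau> = \<rho> \<circ> \<sigma>"
      proof
        fix j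
        show "\<tau> j = (\<rho> \<circ> \<sigma>) j"
        proof (cases "j < n")
          case True
          then have "\<tau> j + \<sigma> j = n - 1" "\<sigma> j < n"
            using * permutes_in_image[OF \<sigma>, of j] by simp_all
          then show ?thesis
            by (simp add: \<rho>_def)
        next
          case False
          then show ?thesis
            using permutes_not_in[OF \<sigma>, of j] permutes_not_in[OF \<tau>, of j]
            by (simp add: \<rho>_def)
        qed
      qed
    next
      assume "\<tau> = \<rho> \<circ> \<sigma>"
      moreover have "\<sigma> j < n" if "j < n" for j
        using permutes_in_image[OF \<sigma>, of j] that by simp
      ultimately show "\<forall>j<n. \<tau> j + \<sigma> j = n - 1"
        by (fastforce simp: \<rho>_def)
    qed
    moreover have "grid_functional n B (\<lambda>b. \<Prod>j<n. b j ^ (\<tau> j + \<sigma> j)) =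
        (if \<forall>j<n. \<tau> j + \<sigma> j = n - 1 then 1 else 0)"
      using n card le by (intro grid_functional_monomial) simp_all
    ultimately show ?thesis
      by simp
  qed
  have expand: "vandermonde n b * power_permanent n (\<lambda>j. b j * c j) =
      (\<Sum>\<sigma>\<in>?S. \<Sum>\<tau>\<in>?S. (of_int (sign \<tau>) * (\<Prod>j<n. c j ^ \<sigma> j)) * (\<Prod>j<n. b j ^ (\<tau> j + \<sigma> j)))" for b
    unfolding vandermonde_Leibniz power_permanent_def sum_product
    by (subst sum.swap)
      (simp add: power_mult_distrib power_add prod.distrib mult_ac)
  have "grid_functional n B (\<lambda>b. vandermonde n b * power_permanent n (\<lambda>j. b j * c j)) =
      (\<Sum>\<sigma>\<in>?S. \<Sum>\<tau>\<in>?S. (of_int (sign \<tau>) * (\<Prod>j<n. c j ^ \<sigma> j)) * (if \<tau> = \<rho> \<circ> \<sigma> then 1 else 0))"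
    unfolding expand grid_functional_sum grid_functional_cmult
    by (intro sum.cong refl arg_cong2[where f = "(*)"]) (auto simp: L_mono)
  also have "\<dots> = (\<Sum>\<sigma>\<in>?S. of_int (sign (\<rho> \<circ> \<sigma>)) * (\<Prod>j<n. c j ^ \<sigma> j))"
  proof (intro sum.cong refl)
    fix \<sigma> assume "\<sigma> \<in> ?S"
    then have "\<rho> \<circ> \<sigma> \<in> ?S"
      using permutes_compose \<rho> by blast
    then show "(\<Sum>\<tau>\<in>?S. (of_int (sign \<tau>) * (\<Prod>j<n. c j ^ \<sigma> j)) * (if \<tau> = \<rho> \<circ> \<sigma> then 1 else 0)) =
        of_int (sign (\<rho> \<circ> \<sigma>)) * (\<Prod>j<n. c j ^ \<sigma> j)"
      by (simp add: if_distrib[of "(*) _"] sum.delta' finite_permutations cong: if_cong)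
  qed
  also have "\<dots> = of_int (sign \<rho>) * vandermonde n c"
    unfolding vandermonde_Leibniz sum_distrib_left
    using \<rho> by (intro sum.cong refl)
      (simp add: sign_compose permutes_imp_permutation[of "{..<n}"] mult_ac)
  also have "\<dots> \<noteq> 0"
    using c by (simp add: vandermonde_eq_0_iff sign_def)
  finally obtain b where "b \<in> PiE {..<n} B"
    "vandermonde n b * power_permanent n (\<lambda>j. b j * c j) \<noteq> 0"
    by (rule grid_functional_nonzeroE)
  then show ?thesis
    by (intro exI[of _ b]) (auto simp: vandermonde_eq_0_iff PiE_iff)
qed

subsection \<open>Integers with large gaps\<close>

lemma finite_argmax:
  fixes x :: "'i \<Rightarrow> int"
  assumes "finite I" "I \<noteq> {}"
  obtains p where "p \<in> I" "\<And>i. i \<in> I \<Longrightarrow> x i \<le> x p"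
proof -
  have "Max (x ` I) \<in> x ` I"
    using assms by simp
  then obtain p where "p \<in> I" "Max (x ` I) = x p"
    by auto
  then show thesis
    using that[of p] assms by (metis Max_ge finite_imageI imageI)
qed

text \<open>Remove the maximum: the next largest value lies at least \<open>m\<close> below
  it.\<close>

lemma spaced_max_ge:
  fixes x :: "'i \<Rightarrow> int"
  assumes "finite I" "p \<in> I" "\<And>i. i \<in> I \<Longrightarrow> x i \<le> x p" "\<And>i. i \<in> I \<Longrightarrow> 0 \<le> x i"
    and "\<And>i j. i \<in> I \<Longrightarrow> j \<in> I \<Longrightarrow> i \<noteq> j \<Longrightarrow> int m \<le> \<bar>x i - x j\<bar>"
  shows "int m * (int (card I) - 1) \<le> x p"
  using assms
proof (induction "card I" arbitrary: I p)
  case 0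
  then show ?case
    by auto
next
  case (Suc k)
  have card: "card (I - {p}) = k"
    using Suc.hyps Suc.prems by simp
  show ?case
  proof (cases "I - {p} = {}")
    case True
    then have "k = 0"
      using card by (metis card.empty)
    then have "card I = 1"
      using Suc.hyps(2) by simp
    then show ?thesis
      using Suc.prems by simp
  next
    case False
    then obtain q where q: "q \<in> I - {p}" "\<And>i. i \<in> I - {p} \<Longrightarrow> x i \<le> x q"
      using finite_argmax[of "I - {p}" x] Suc.prems(1) by blast
    then have "int m * (int (card (I - {p})) - 1) \<le> x q"
      using Suc.prems card by (intro Suc.hyps(1)) auto
    moreover have "x q \<le> x p"
      using Suc.prems(3) q(1) by blast
    moreover have "int m \<le> \<bar>x p - x q\<bar>"
      using Suc.prems(2) Suc.prems(5)[of p q] q(1) by blast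
    ultimately show ?thesis
      using card Suc.hyps(2) by (simp add: algebra_simps flip: Suc.hyps(2))
  qed
qed

text \<open>Remove the maximum, which is at least m * (card I - 1), and add up. Doubling avoids the
  division in the triangular number.\<close>

lemma spaced_sum_ge:
  fixes x :: "'i \<Rightarrow> int"
  assumes "finite I" "\<And>i. i \<in> I \<Longrightarrow> 0 \<le> x i"
    and "\<And>i j. i \<in> I \<Longrightarrow> j \<in> I \<Longrightarrow> i \<noteq> j \<Longrightarrow> int m \<le> \<bar>x i - x j\<bar>"
  shows "int m * (int (card I) * (int (card I) - 1)) \<le> 2 * (\<Sum>i\<in>I. x i)"
  using assms
proof (induction "card I" arbitrary: I)
  case 0
  then show ?case
    by auto
next
  case (Suc k)
  then have "I \<noteq> {}"
    by auto
  then obtain p where p: "p \<in> I" "\<And>i. i \<in> I \<Longrightarrow> x i \<le> x p"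
    using finite_argmax Suc.prems(1) by blast
  have card: "card (I - {p}) = k"
    using Suc.hyps Suc.prems p by simp
  have "int m * (int (card (I - {p})) * (int (card (I - {p})) - 1)) \<le> 2 * (\<Sum>i\<in>I - {p}. x i)"
    using Suc.prems card by (intro Suc.hyps(1)) auto
  moreover have "int m * (int (card I) - 1) \<le> x p"
    using Suc.prems p by (intro spaced_max_ge) auto
  moreover have "(\<Sum>i\<in>I. x i) = x p + (\<Sum>i\<in>I - {p}. x i)"
    using Suc.prems p by (simp add: sum.remove)
  ultimately show ?case
    using card by (simp add: algebra_simps flip: Suc.hyps(2))
qed

text \<open>Equality in the sum bound forces equality at each removal of a maximum, so the values
  are 0, m, 2m and so on. The half-open interval forbids a descent by exactly \<open>m\<close> as
  the index grows, so the values increase with the index.\<close>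

lemma spaced_sum_eqD:
  fixes x :: "nat \<Rightarrow> int"
  assumes m: "0 < m" and "finite I" "\<And>i. i \<in> I \<Longrightarrow> 0 \<le> x i"
    and "\<And>i j. i \<in> I \<Longrightarrow> j \<in> I \<Longrightarrow> i < j \<Longrightarrow> x j - x i \<notin> {- int m..<int m}"
    and "2 * (\<Sum>i\<in>I. x i) = int m * (int (card I) * (int (card I) - 1))"
    and "i \<in> I"
  shows "x i = int m * int (card {j\<in>I. j < i})"
  using assms(2-)
proof (induction "card I" arbitrary: I i)
  case 0
  then show ?case
    by auto
next
  case (Suc k)
  have spaced: "int m \<le> \<bar>x i - x j\<bar>" if "i \<in> I" "j \<in> I" "i \<noteq> j" for i j
    using Suc.prems(3)[of i j] Suc.prems(3)[of j i] that by (cases i j rule: linorder_cases) auto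
  obtain p where p: "p \<in> I" "\<And>i. i \<in> I \<Longrightarrow> x i \<le> x p"
    using finite_argmax[of I x] Suc.prems(1,5) by blast
  define J where "J = I - {p}"
  have card: "card J = k"
    using Suc.hyps Suc.prems p by (simp add: J_def)
  have J: "finite J" "J \<subseteq> I" "p \<notin> J" "I = insert p J"
    using Suc.prems p by (auto simp: J_def)
  have "int m * (int (card J) * (int (card J) - 1)) \<le> 2 * (\<Sum>i\<in>J. x i)"
    using Suc.prems(2) J spaced by (intro spaced_sum_ge) auto
  moreover have "int m * (int (card I) - 1) \<le> x p"
    using Suc.prems(1,2) p spaced by (intro spaced_max_ge) auto
  moreover have "(\<Sum>i\<in>I. x i) = x p + (\<Sum>i\<in>J. x i)"
    using J by simp
  ultimately have sum_J: "2 * (\<Sum>i\<in>J. x i) = int m * (int (card J) * (int (card J) - 1))"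
    and x_p: "x p = int m * int k"
    using card Suc.prems(4) by (simp_all add: algebra_simps flip: Suc.hyps(2))
  have x_J: "x i = int m * int (card {j\<in>J. j < i})" if "i \<in> J" for i
    using Suc.prems(2,3) J card sum_J that by (intro Suc.hyps(1)) auto
  have less_p: "j < p" if "j \<in> J" for j
  proof -
    \<comment> \<open>By induction the last index of \<open>J\<close> has the largest value there,
      exactly \<open>m\<close> below \<open>x p\<close>. If it came after \<open>p\<close>, the
      difference would be the excluded -m.\<close>
    define q where "q = Max J"
    have "J \<noteq> {}"
      using that by auto
    have q: "q \<in> J" "j \<le> q" "{j\<in>J. j < q} = J - {q}"
      using Max_in[OF J(1) \<open>J \<noteq> {}\<close>] Max_ge[of J] that J(1) by (auto simp: q_def order_less_le)
    have "0 < k"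
      using J(1) \<open>J \<noteq> {}\<close> card by (metis card_gt_0_iff)
    then have "x q = int m * (int k - 1)"
      using x_J[OF q(1)] q card J(1) by (simp add: of_nat_diff Suc_leI)
    then have "x p - x q = int m"
      by (simp add: x_p algebra_simps)
    then have "x q - x p \<in> {- int m..<int m}"
      using m by simp
    then have "\<not> p < q"
      using Suc.prems(3)[OF p(1), of q] q(1) J(2) by blast
    moreover have "q \<noteq> p"
      using q J by auto
    ultimately show ?thesis
      using q by simp
  qed
  show ?case
  proof (cases "i = p")
    case True
    have "{j\<in>I. j < p} = J"
      using J less_p by auto
    then show ?thesis
      using True card x_p by simp
  next
    case False
    then have "i \<in> J"
      using Suc.prems(5) J by auto
    moreover have "{j\<in>I. j < i} = {j\<in>J. j < i}"
      using J less_p[OF \<open>i \<in> J\<close>] by auto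
    ultimately show ?thesis
      using x_J by simp
  qed
qed

lemma two_sum_lessThan: "2 * \<Sum>{..<n} = n * (n - 1)" for n :: nat
  by (induction n) (auto simp: algebra_simps diff_Suc split: nat.split)

text \<open>
  The numbers lie in an interval so short that the pairwise gaps confine their sum to
  \<open>l * n + 1\<close> consecutive values; excluding all but the smallest one leaves a single
  configuration.
\<close>

lemma spaced_configuration_unique:
  fixes x :: "nat \<Rightarrow> int"
  assumes m: "0 < m"
    and range: "\<And>i. i < n \<Longrightarrow> x i \<in> {0..int (l + m * (n - 1))}"
    and gaps: "\<And>i j. i < j \<Longrightarrow> j < n \<Longrightarrow> x j - x i \<notin> {- int m..<int m}"
    and sum: "(\<Sum>i<n. x i) \<notin> (\<lambda>u. int (m * \<Sum>{..<n}) + int u) ` {1..l * n}"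
    and i: "i < n"
  shows "x i = int (m * i)"
proof -
  have spaced: "int m \<le> \<bar>x i - x j\<bar>" if "i < n" "j < n" "i \<noteq> j" for i j
    using gaps[of i j] gaps[of j i] that by (cases i j rule: linorder_cases) auto
  define g where "g = \<Sum>{..<n}"
  define M where "M = int (m * g)"
  have "int (2 * g) = int (n * (n - 1))"
    by (simp only: g_def two_sum_lessThan)
  then have "2 * int g = int n * (int n - 1)"
    using i by (simp add: of_nat_diff)
  then have M: "2 * M = int m * (int n * (int n - 1))"
    by (simp add: M_def)
  have lower: "int m * (int n * (int n - 1)) \<le> 2 * (\<Sum>i<n. x i)"
    using spaced_sum_ge[of "{..<n}" x m] range spaced by simp
  \<comment> \<open>The reflection x \<mapsto> K - x preserves the gaps, so the lower bound on sums
    also yields the upper one.\<close>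
  define K where "K = int (l + m * (n - 1))"
  have "int m * (int n * (int n - 1)) \<le> 2 * (\<Sum>i<n. K - x i)"
    using spaced_sum_ge[of "{..<n}" "\<lambda>i. K - x i" m] range spaced
    by (simp add: K_def abs_minus_commute)
  also have "\<dots> = 2 * int n * K - 2 * (\<Sum>i<n. x i)"
    by (simp add: sum_subtractf)
  finally have "int m * (int n * (int n - 1)) \<le> 2 * int n * K - 2 * (\<Sum>i<n. x i)" .
  moreover have "K = int l + int m * (int n - 1)"
    using i by (simp add: K_def)
  ultimately have upper: "(\<Sum>i<n. x i) \<le> M + int (l * n)"
    using M by (simp add: algebra_simps)
  have "(\<Sum>i<n. x i) = M"
  proof (rule ccontr)
    assume "(\<Sum>i<n. x i) \<noteq> M"
    then have "(\<Sum>i<n. x i) = M + int (nat ((\<Sum>i<n. x i) - M))"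
      "1 \<le> nat ((\<Sum>i<n. x i) - M)"
      using lower M by auto
    moreover have "nat ((\<Sum>i<n. x i) - M) \<le> l * n"
      using upper by (simp add: nat_le_iff)
    ultimately show False
      using sum unfolding M_def g_def by (metis atLeastAtMost_iff image_eqI)
  qed
  then have "x i = int m * int (card {j\<in>{..<n}. j < i})"
    using m range gaps i M by (intro spaced_sum_eqD) auto
  moreover have "{j\<in>{..<n}. j < i} = {..<i}"
    using i by auto
  ultimately show ?thesis
    by simp
qed

subsection \<open>The coefficient of the product of forms\<close>

text \<open>
  \<open>Inl ((j, i), s)\<close> indexes the copies of the form \<open>a j - a i\<close>, the one with \<open>s = 0\<close> being twisted
  to \<open>y j * a j - y i * a i\<close>; \<open>Inr u\<close> indexes the copies of the sum of all variables.
\<close>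

type_synonym form_index = "((nat \<times> nat) \<times> nat) + nat"

definition form_indices :: "nat \<Rightarrow> nat \<Rightarrow> nat \<Rightarrow> form_index set" where
  "form_indices n m N = ((SIGMA j:{..<n}. {..<j}) \<times> {..<2 * m}) <+> {..<N}"

definition form_coeff :: "(nat \<Rightarrow> 'a) \<Rightarrow> form_index \<Rightarrow> nat \<Rightarrow> 'a::comm_ring_1" where
  "form_coeff y t r = (case t of
     Inl ((j, i), s) \<Rightarrow> (if s = 0 then y r else 1) * (if r = j then 1 else if r = i then -1 else 0)
   | Inr u \<Rightarrow> 1)"

text \<open>There are 2m n(n-1)/2 + l n = n (l + m (n-1)) forms, so equal exponents l + m (n-1) in
  all \<open>n\<close> variables exhaust the degree.\<close>

definition leading_coeff :: "nat \<Rightarrow> nat \<Rightarrow> nat \<Rightarrow> (nat \<Rightarrow> 'a) \<Rightarrow> 'a::comm_ring_1" where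
  "leading_coeff n m l y =
    linear_forms_coeff n (form_indices n m (l * n)) (\<lambda>_. l + m * (n - 1)) (form_coeff y)"

text \<open>For y = 1 the forms have coefficients 0, 1 and -1. One integer thus serves the
  rationals, where it is evaluated, and the field, where it must not vanish.\<close>

lemma leading_coeff_1_of_int:
  "of_int (leading_coeff n m l (\<lambda>_. 1)) = leading_coeff n m l (\<lambda>_. 1)"
  unfolding leading_coeff_def linear_forms_coeff_of_int[symmetric]
  by (rule arg_cong[of _ _ "linear_forms_coeff n _ _"])
    (auto simp: form_coeff_def fun_eq_iff split: sum.splits prod.splits)

text \<open>The constants \<open>z\<close> and \<open>w\<close> stay free: zero exposes the
  symmetry, special shifts make the value computable, and the forbidden values give the
  theorem.\<close>

lemma grid_functional_leading_coeff:
  fixes A :: "nat \<Rightarrow> 'a::field set"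
  assumes "\<And>i. i < n \<Longrightarrow> card (A i) = Suc (l + m * (n - 1))"
  shows "grid_functional n A (\<lambda>a.
      (\<Prod>j<n. \<Prod>i<j. \<Prod>s<2 * m. (if s = 0 then y j * a j - y i * a i else a j - a i) - z j i s) *
      (\<Prod>u<l * n. (\<Sum>i<n. a i) - w u)) = leading_coeff n m l y"
proof -
  let ?T = "form_indices n m (l * n)"
  define \<beta> where "\<beta> t = (case t of Inl ((j, i), s) \<Rightarrow> z j i s | Inr u \<Rightarrow> w u)" for t :: form_index
  have fin: "finite ?T"
    by (simp add: form_indices_def)
  have "card ?T = 2 * m * \<Sum>{..<n} + l * n"
    by (simp add: form_indices_def card_Plus card_cartesian_product)
  also have "\<dots> = (\<Sum>i<n. l + m * (n - 1))"
    using two_sum_lessThan[of n] by (simp add: algebra_simps)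
  finally have card: "card ?T = (\<Sum>i<n. l + m * (n - 1))" .
  have pair: "(\<Sum>r<n. form_coeff y (Inl ((j, i), s)) r * a r) =
      (if s = 0 then y j * a j - y i * a i else a j - a i)" if "i < j" "j < n" for a i j s
  proof -
    have "(\<Sum>r<n. form_coeff y (Inl ((j, i), s)) r * a r) =
        (\<Sum>r\<in>{i, j}. form_coeff y (Inl ((j, i), s)) r * a r)"
      using that by (intro sum.mono_neutral_right) (auto simp: form_coeff_def)
    then show ?thesis
      using that by (simp add: form_coeff_def)
  qed
  have prod_indices: "(\<Prod>x\<in>(SIGMA j:{..<n}. {..<j}) \<times> {..<2 * m}. g x) =
      (\<Prod>j<n. \<Prod>i<j. \<Prod>s<2 * m. g ((j, i), s))" for g :: "_ \<Rightarrow> 'a"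
  proof -
    have "(\<Prod>x\<in>(SIGMA j:{..<n}. {..<j}) \<times> {..<2 * m}. g x) =
        (\<Prod>p\<in>(SIGMA j:{..<n}. {..<j}). \<Prod>s<2 * m. g (p, s))"
      by (simp add: prod.cartesian_product split_def)
    also have "\<dots> = (\<Prod>j<n. \<Prod>i<j. \<Prod>s<2 * m. g ((j, i), s))"
      by (subst prod.Sigma) (auto simp: split_def)
    finally show ?thesis .
  qed
  have "(\<Prod>t\<in>?T. (\<Sum>r<n. form_coeff y t r * a r) - \<beta> t) =
      (\<Prod>j<n. \<Prod>i<j. \<Prod>s<2 * m. (if s = 0 then y j * a j - y i * a i else a j - a i) - z j i s) *
      (\<Prod>u<l * n. (\<Sum>i<n. a i) - w u)" for a
  proof -
    have "(\<Prod>t\<in>?T. (\<Sum>r<n. form_coeff y t r * a r) - \<beta> t) =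
      (\<Prod>j<n. \<Prod>i<j. \<Prod>s<2 * m. (\<Sum>r<n. form_coeff y (Inl ((j, i), s)) r * a r) - z j i s) *
      (\<Prod>u<l * n. (\<Sum>r<n. form_coeff y (Inr u) r * a r) - w u)"
      unfolding form_indices_def
      by (subst prod.Plus) (simp_all add: prod_indices \<beta>_def)
    also have "\<dots> = (\<Prod>j<n. \<Prod>i<j. \<Prod>s<2 * m. (if s = 0 then y j * a j - y i * a i else a j - a i) - z j i s) *
      (\<Prod>u<l * n. (\<Sum>i<n. a i) - w u)"
      by (intro arg_cong2[where f = "(*)"] prod.cong refl)
        (simp_all only: pair lessThan_iff, simp add: form_coeff_def)
    finally show ?thesis .
  qed
  then show ?thesis
    using grid_functional_prod_linear[OF fin card, of A "form_coeff y" \<beta>] assms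
    by (simp add: leading_coeff_def)
qed

text \<open>With zero constants the untwisted differences form an odd power of the Vandermonde
  product, and the power of the sum is symmetric. Their product \<open>P\<close> is antisymmetric,
  and the twisted differences supply the Vandermonde product in y j * a j.\<close>

lemma leading_coeff_permanent:
  fixes A :: "'a::field set"
  assumes m: "0 < m" and card: "card A = Suc (l + m * (n - 1))"
  obtains C where "\<And>y :: nat \<Rightarrow> 'a. leading_coeff n m l y = power_permanent n y * C"
proof -
  define P where "P a = vandermonde n a ^ (2 * m - 1) * (\<Sum>i<n. a i) ^ (l * n)" for a :: "nat \<Rightarrow> 'a"
  have P: "P (a \<circ> \<tau>) = of_int (sign \<tau>) * P a" if \<tau>: "\<tau> permutes {..<n}" for \<tau> a
  proof -
    have "(\<Sum>i<n. (a \<circ> \<tau>) i) = (\<Sum>i<n. a i)"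
      using sum.reindex_bij_betw[OF permutes_imp_bij[OF \<tau>], of a] by simp
    moreover have "of_int (sign \<tau>) ^ (2 * m - 1) = (of_int (sign \<tau>) :: 'a)"
      using m by (auto simp: sign_def)
    ultimately show ?thesis
      by (simp only: P_def vandermonde_permute[OF \<tau>] power_mult_distrib mult.assoc)
  qed
  have split: "(\<Prod>s<2 * m. (if s = 0 then p else q) - 0) = p * q ^ (2 * m - 1)" for p q :: 'a
  proof -
    obtain N where "2 * m = Suc N"
      using m by (cases "2 * m") auto
    then show ?thesis
      by (simp add: prod.lessThan_Suc_shift del: prod.lessThan_Suc)
  qed
  have "leading_coeff n m l y = power_permanent n y *
      grid_functional n (\<lambda>_. A) (\<lambda>a. P a * (\<Prod>j<n. a j ^ j))" for y
  proof -
    have "leading_coeff n m l y = grid_functional n (\<lambda>_. A) (\<lambda>a.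
        (\<Prod>j<n. \<Prod>i<j. \<Prod>s<2 * m. (if s = 0 then y j * a j - y i * a i else a j - a i) - 0) *
        (\<Prod>u<l * n. (\<Sum>i<n. a i) - 0))"
      using grid_functional_leading_coeff[of n "\<lambda>_. A" l m y "\<lambda>_ _ _. 0" "\<lambda>_. 0"] card by simp
    also have "\<dots> = grid_functional n (\<lambda>_. A) (\<lambda>a. P a * vandermonde n (\<lambda>j. y j * a j))"
      unfolding split by (simp add: P_def vandermonde_def prod.distrib prod_power_distrib mult_ac)
    finally show ?thesis
      by (simp add: grid_functional_vandermonde_twist[of n P, OF P])
  qed
  then show thesis
    by (rule that)
qed

text \<open>
  The coefficient does not depend on the constant terms, so the even powers of differences may be
  replaced by products over shifts chosen to vanish at all but one point of the grid.
\<close>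

lemma leading_coeff_int_dvd:
  assumes m: "0 < m"
  shows "leading_coeff n m l (\<lambda>_. 1 :: int) dvd
    (\<Prod>j<n. \<Prod>i<j. \<Prod>s<2 * m. int ((j - i) * m + m - s)) * (\<Prod>u<l * n. - int (Suc u))"
proof -
  define K where "K = l + m * (n - 1)"
  define A where "A = (of_int :: int \<Rightarrow> rat) ` {0..int K}"
  have card_A: "card A = Suc K"
    by (simp add: A_def card_image inj_on_def nat_add_distrib)
  define x0 where "x0 = (\<lambda>i\<in>{..<n}. of_nat (m * i) :: rat)"
  \<comment> \<open>The shifts s - m run through -m, ..., m - 1, and the sums through the
    \<open>l * n\<close> values just above the minimum. Only the tightest increasing configuration
    \<open>x0\<close> escapes all of them.\<close>
  define F where "F a = (\<Prod>j<n. \<Prod>i<j. \<Prod>s<2 * m. (if s = 0 then 1 * a j - 1 * a i else a j - a i) - (of_nat s - of_nat m)) *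
      (\<Prod>u<l * n. (\<Sum>i<n. a i) - of_nat (m * \<Sum>{..<n} + Suc u))" for a :: "nat \<Rightarrow> rat"
  have le_K: "m * i \<le> K" if "i < n" for i
    using that by (auto simp: K_def intro!: trans_le_add2)
  have x0: "x0 \<in> {..<n} \<rightarrow>\<^sub>E A"
  proof
    fix i assume "i \<in> {..<n}"
    then have "int (m * i) \<in> {0..int K}" "x0 i = of_int (int (m * i))"
      using le_K[of i] by (simp_all add: x0_def flip: of_nat_mult)
    then show "x0 i \<in> A"
      unfolding A_def by blast
  qed (simp add: x0_def)
  have unique: "a = x0" if a: "a \<in> {..<n} \<rightarrow>\<^sub>E A" and F: "F a \<noteq> 0" for a
  proof -
    define x where "x i = \<lfloor>a i\<rfloor>" for i
    have x: "a i = of_int (x i)" "x i \<in> {0..int K}" if "i < n" for i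
      using PiE_mem[OF a, of i] that by (auto simp: A_def x_def)
    have "x i = int (m * i)" if "i < n" for i
    proof (rule spaced_configuration_unique[of m n x l])
      show "x i \<in> {0..int (l + m * (n - 1))}" if "i < n" for i
        using x(2)[OF that] by (simp add: K_def)
      show "x j - x i \<notin> {- int m..<int m}" if "i < j" "j < n" for i j
      proof
        assume "x j - x i \<in> {- int m..<int m}"
        then have "nat (x j - x i + int m) < 2 * m" "x j - x i = int (nat (x j - x i + int m)) - int m"
          by auto
        then obtain s where s: "s < 2 * m" "x j - x i = int s - int m"
          by blast
        have "(if s = 0 then 1 * a j - 1 * a i else a j - a i) - (of_nat s - of_nat m) =
            of_int (x j - x i - (int s - int m))"
          using that by (simp add: x)
        also have "\<dots> = 0"
          using s by simp
        finally show False
          using F s that by (auto simp: F_def)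
      qed
      show "(\<Sum>i<n. x i) \<notin> (\<lambda>u. int (m * \<Sum>{..<n}) + int u) ` {1..l * n}"
      proof
        assume "(\<Sum>i<n. x i) \<in> (\<lambda>u. int (m * \<Sum>{..<n}) + int u) ` {1..l * n}"
        then obtain u where u: "u \<in> {1..l * n}" "(\<Sum>i<n. x i) = int (m * \<Sum>{..<n}) + int u"
          by blast
        have "(\<Sum>i<n. a i) = of_int (\<Sum>i<n. x i)"
          by (simp add: x)
        also have "\<dots> = of_nat (m * \<Sum>{..<n} + Suc (u - 1))"
          using u by simp
        finally show False
          using F u(1) by (auto simp: F_def dest!: bspec[of _ _ "u - 1"])
      qed
    qed fact+
    then show ?thesis
      using a x(1) by (auto simp: x0_def PiE_iff extensional_def restrict_def fun_eq_iff)
  qed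
  \<comment> \<open>Clearing the denominators of the weights at \<open>x0\<close> gives coefficient
    * D = F x0, an identity between integers.\<close>
  define D where "D = (\<Prod>i<n. \<Prod>b\<in>{0..int K} - {int (m * i)}. int (m * i) - b)"
  have weight: "of_int (\<Prod>b\<in>{0..int K} - {int (m * i)}. int (m * i) - b) * lagrange_weight A (x0 i) = 1"
    if "i < n" for i
  proof -
    have "x0 i = of_int (int (m * i))"
      using that by (simp add: x0_def)
    then have "A - {x0 i} = of_int ` ({0..int K} - {int (m * i)})"
      unfolding A_def by (subst image_set_diff) (auto simp: inj_on_def)
    then have "lagrange_weight A (x0 i) =
        (\<Prod>b\<in>{0..int K} - {int (m * i)}. inverse (of_int (int (m * i) - b)))"
      using that by (simp add: lagrange_weight_def prod.reindex inj_on_def x0_def)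
    then show ?thesis
      by (simp add: of_int_prod flip: prod.distrib del: of_int_diff)
  qed
  have "of_int (leading_coeff n m l (\<lambda>_. 1)) = (leading_coeff n m l (\<lambda>_. 1) :: rat)"
    by (rule leading_coeff_1_of_int)
  also have "\<dots> = grid_functional n (\<lambda>_. A) F"
    unfolding F_def
    by (rule grid_functional_leading_coeff[symmetric]) (simp add: card_A K_def)
  also have "\<dots> = (\<Sum>a\<in>{x0}. F a * (\<Prod>i<n. lagrange_weight A (a i)))"
    unfolding grid_functional_def
    by (rule sum.mono_neutral_right) (use x0 unique in \<open>auto simp: A_def intro!: finite_PiE\<close>)
  finally have "of_int (leading_coeff n m l (\<lambda>_. 1)) * of_int D =
      F x0 * (\<Prod>i<n. of_int (\<Prod>b\<in>{0..int K} - {int (m * i)}. int (m * i) - b) * lagrange_weight A (x0 i))"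
    by (simp add: D_def prod.distrib mult_ac)
  also have "\<dots> = F x0"
    using weight by simp
  also have "F x0 = of_int ((\<Prod>j<n. \<Prod>i<j. \<Prod>s<2 * m. int ((j - i) * m + m - s)) * (\<Prod>u<l * n. - int (Suc u)))"
  proof -
    have "(if s = 0 then 1 * x0 j - 1 * x0 i else x0 j - x0 i) - (of_nat s - of_nat m) =
        of_int (int ((j - i) * m + m - s))" if "j < n" "i < j" "s < 2 * m" for i j s
    proof -
      have "m \<le> (j - i) * m"
        using that by (cases "j - i") auto
      then have "s \<le> (j - i) * m + m"
        using that(3) by linarith
      then have "of_int (int ((j - i) * m + m - s)) = (of_nat ((j - i) * m + m) - of_nat s :: rat)"
        by (simp only: of_int_of_nat_eq of_nat_diff)
      moreover obtain d where "j = i + d"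
        using \<open>i < j\<close> by (metis less_imp_add_positive)
      ultimately show ?thesis
        using that by (simp add: x0_def algebra_simps)
    qed
    moreover have "(\<Sum>i<n. x0 i) = of_nat (m * \<Sum>{..<n})"
      by (simp add: x0_def sum_distrib_left)
    ultimately show ?thesis
      unfolding F_def of_int_mult of_int_prod
      by (intro arg_cong2[where f = "(*)"] prod.cong refl) auto
  qed
  finally show ?thesis
    by (intro dvdI[of _ _ D]) (simp only: of_int_eq_iff flip: of_int_mult)
qed

section \<open>Nonvanishing of the coefficient in the field\<close>

lemma of_nat_neq_0_if_less_ch:
  assumes "0 < v" "enat v < ch TYPE('a::field)"
  shows "of_nat v \<noteq> (0 :: 'a)"
  using assms by (auto simp: ch_def of_nat_eq_0_iff_char_dvd dest: dvd_imp_le split: if_splits)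

text \<open>The integer coefficient divides a product whose factors are, up to sign, positive
  integers at most m * n or at most l * n. All of these are nonzero in the field, hence so is the
  divisor.\<close>

lemma leading_coeff_1_neq_0:
  assumes m: "0 < m" and ch: "enat (max (m * n) (l * n)) < ch TYPE('a::field)"
  shows "leading_coeff n m l (\<lambda>_. 1) \<noteq> (0 :: 'a)"
proof -
  define R where "R = (\<Prod>j<n. \<Prod>i<j. \<Prod>s<2 * m. int ((j - i) * m + m - s)) * (\<Prod>u<l * n. - int (Suc u))"
  have nz: "of_nat v \<noteq> (0 :: 'a)" if "0 < v" "v \<le> m * n \<or> v \<le> l * n" for v
    using that ch by (intro of_nat_neq_0_if_less_ch) (auto elim: le_less_trans[rotated])
  have "of_int (leading_coeff n m l (\<lambda>_. 1)) = (leading_coeff n m l (\<lambda>_. 1) :: 'a)"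
    by (rule leading_coeff_1_of_int)
  moreover obtain D where "R = leading_coeff n m l (\<lambda>_. 1) * D"
    using leading_coeff_int_dvd[OF m] unfolding R_def by blast
  moreover have "of_int R \<noteq> (0 :: 'a)"
  proof -
    have "of_nat ((j - i) * m + m - s) \<noteq> (0 :: 'a)" if "j < n" "i < j" "s < 2 * m" for i j s
    proof (rule nz)
      have "m \<le> (j - i) * m"
        using that by (cases "j - i") auto
      then have "s < (j - i) * m + m"
        using that(3) by linarith
      then show "0 < (j - i) * m + m - s"
        by simp
      have "(j - i) * m + m - s \<le> Suc (j - i) * m"
        by simp
      also have "\<dots> \<le> n * m"
        using that by (intro mult_le_mono1) simp
      finally show "(j - i) * m + m - s \<le> m * n \<or> (j - i) * m + m - s \<le> l * n"
        by (simp add: mult.commute)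
    qed
    moreover have "of_nat (Suc u) \<noteq> (0 :: 'a)" if "u < l * n" for u
      using that by (intro nz) auto
    ultimately show ?thesis
      by (auto simp: R_def simp del: of_nat_Suc)
  qed
  ultimately show ?thesis
    by (metis mult_zero_left of_int_mult)
qed

subsection \<open>Distinct representatives and restricted sums\<close>

text \<open>Allowing repetitions and extra values lets a set of at most \<open>N\<close> elements
  fill exactly \<open>N\<close> slots of constants.\<close>

lemma finite_subset_image_lessThan:
  assumes "finite X" "card X \<le> N"
  obtains h where "X \<subseteq> h ` {..<N}"
proof -
  obtain h where "bij_betw h {0..<card X} X"
    using ex_bij_betw_nat_finite[OF assms(1)] by blast
  then have "X = h ` {0..<card X}"
    by (simp add: bij_betw_def)
  also have "\<dots> \<subseteq> h ` {..<N}"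
    using assms(2) by (intro image_mono) auto
  finally show thesis
    by (rule that)
qed

theorem theorem1p4:
  fixes k m n :: nat
    and c :: "nat \<Rightarrow> 'a::field"
    and A B :: "nat \<Rightarrow> 'a set"
    and S :: "nat \<Rightarrow> nat \<Rightarrow> 'a set"
  assumes "0 < k" "0 < m" "0 < n"
    and "k - 1 \<ge> m * (n - 1)"
    and "ch TYPE('a) > enat (max (m * n) ((k - 1 - m * (n - 1)) * n))"
    and "inj_on c {1..n}"
    and "\<And>i. i \<in> {1..n} \<Longrightarrow> card (A i) = k"
    and "\<And>i. i \<in> {1..n} \<Longrightarrow> card (B i) = n"
    and "\<And>i j. 1 \<le> i \<Longrightarrow> i < j \<Longrightarrow> j \<le> n \<Longrightarrow> finite (S i j) \<and> card (S i j) < 2 * m"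
  shows "\<exists>b. is_SDR n B b \<and>
    card {(\<Sum>i=1..n. a i) | a.
        (\<forall>i\<in>{1..n}. a i \<in> A i) \<and>
        (\<forall>i j. 1 \<le> i \<and> i < j \<and> j \<le> n \<longrightarrow>
           a i - a j \<notin> S i j \<and> a i * b i * c i \<noteq> a j * b j * c j)}
      \<ge> (k - 1 - m * (n - 1)) * n + 1"
proof -
  define l where "l = k - 1 - m * (n - 1)"
  \<comment> \<open>The grid is indexed from 0, the given families from 1.\<close>
  define A' where "A' i = A (Suc i)" for i
  have k: "k = Suc (l + m * (n - 1))"
    using assms(1,4) by (simp add: l_def)
  have card_A': "card (A' i) = Suc (l + m * (n - 1))" if "i < n" for i
    using assms(7)[of "Suc i"] that by (simp add: A'_def k)
  have inj_c: "inj_on (\<lambda>i. c (Suc i)) {..<n}"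
  proof (rule inj_onI)
    fix i j assume "i \<in> {..<n}" "j \<in> {..<n}" "c (Suc i) = c (Suc j)"
    then show "i = j"
      using inj_onD[OF assms(6), of "Suc i" "Suc j"] by simp
  qed
  have card_B: "card (B (Suc i)) = n" if "i < n" for i
    using assms(8)[of "Suc i"] that by simp
  obtain b where b: "\<forall>i<n. b i \<in> B (Suc i)" "inj_on b {..<n}"
    "power_permanent n (\<lambda>i. b i * c (Suc i)) \<noteq> 0"
    using exists_SDR_power_permanent[of n "\<lambda>i. c (Suc i)" "\<lambda>i. B (Suc i)", OF assms(3) inj_c card_B]
    by auto
  define y where "y i = b i * c (Suc i)" for i
  have coeff: "leading_coeff n m l y \<noteq> 0"
  proof -
    obtain C where C: "\<And>y :: nat \<Rightarrow> 'a. leading_coeff n m l y = power_permanent n y * C"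
      using leading_coeff_permanent[OF assms(2) card_A'[OF assms(3)]] by blast
    \<comment> \<open>At y = 1 this shows that the common factor \<open>C\<close> is
      nonzero.\<close>
    moreover have "leading_coeff n m l (\<lambda>_. 1) \<noteq> (0 :: 'a)"
      using assms(2,5) by (intro leading_coeff_1_neq_0) (simp_all add: l_def)
    ultimately show ?thesis
      using b(3) by (auto simp: y_def[abs_def])
  qed
  define X where "X = {(\<Sum>i=1..n. a i) | a.
    (\<forall>i\<in>{1..n}. a i \<in> A i) \<and>
    (\<forall>i j. 1 \<le> i \<and> i < j \<and> j \<le> n \<longrightarrow>
       a i - a j \<notin> S i j \<and> a i * b (i - 1) * c i \<noteq> a j * b (j - 1) * c j)}"
  \<comment> \<open>An infinite set has \<open>card\<close> 0, so finiteness must precede any lower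
    bound; it also allows \<open>X\<close> to be listed.\<close>
  have "finite X"
  proof (rule finite_subset)
    have fin: "finite (A i)" if "i \<in> {1..n}" for i
      using assms(1) assms(7)[OF that] by (metis card.infinite less_not_refl)
    then show "finite ((\<lambda>a. \<Sum>i=1..n. a i) ` PiE {1..n} A)"
      by (intro finite_imageI finite_PiE) auto
    show "X \<subseteq> (\<lambda>a. \<Sum>i=1..n. a i) ` PiE {1..n} A"
    proof
      fix t assume "t \<in> X"
      then obtain a where "t = (\<Sum>i=1..n. a i)" "\<forall>i\<in>{1..n}. a i \<in> A i"
        unfolding X_def by blast
      then show "t \<in> (\<lambda>a. \<Sum>i=1..n. a i) ` PiE {1..n} A"
        by (intro image_eqI[of _ _ "restrict a {1..n}"]) auto
    qed
  qed
  have "l * n < card X"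
  proof (rule ccontr)
    assume "\<not> l * n < card X"
    then obtain w where w: "X \<subseteq> w ` {..<l * n}"
      using finite_subset_image_lessThan[OF \<open>finite X\<close>] by (metis not_less)
    have "\<exists>h. S (Suc i) (Suc j) \<subseteq> h ` {..<2 * m - 1}" if "i < j" "j < n" for i j
    proof -
      have "finite (S (Suc i) (Suc j))" "card (S (Suc i) (Suc j)) \<le> 2 * m - 1"
        using assms(9)[of "Suc i" "Suc j"] that by auto
      then show ?thesis
        by (meson finite_subset_image_lessThan)
    qed
    then obtain h where h: "\<And>i j. i < j \<Longrightarrow> j < n \<Longrightarrow> S (Suc i) (Suc j) \<subseteq> h i j ` {..<2 * m - 1}"
      by metis
    \<comment> \<open>Slot 0 holds the twisted form and tests equality of the products. The other 2m
      - 1 slots exclude the values of \<open>S\<close>, negated because the forms are a j - a i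
      while \<open>S\<close> restricts a i - a j.\<close>
    define z where "z j i s = (if s = 0 then 0 else - h i j (s - 1))" for i j s :: nat
    have "grid_functional n A' (\<lambda>a.
        (\<Prod>j<n. \<Prod>i<j. \<Prod>s<2 * m. (if s = 0 then y j * a j - y i * a i else a j - a i) - z j i s) *
        (\<Prod>u<l * n. (\<Sum>i<n. a i) - w u)) \<noteq> 0"
      using coeff by (subst grid_functional_leading_coeff[OF card_A'])
    then obtain a where a: "a \<in> PiE {..<n} A'"
      "(\<Prod>j<n. \<Prod>i<j. \<Prod>s<2 * m. (if s = 0 then y j * a j - y i * a i else a j - a i) - z j i s) *
        (\<Prod>u<l * n. (\<Sum>i<n. a i) - w u) \<noteq> 0"
      by (rule grid_functional_nonzeroE)
    have factor: "(if s = 0 then y j * a j - y i * a i else a j - a i) - z j i s \<noteq> 0"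
      if "i < j" "j < n" "s < 2 * m" for i j s
      using a(2) that by auto
    have "(\<Sum>i=1..n. a (i - 1)) \<in> X"
      unfolding X_def
    proof (intro CollectI exI[of _ "\<lambda>i. a (i - 1)"] conjI ballI allI impI refl)
      fix i assume "i \<in> {1..n}"
      then show "a (i - 1) \<in> A i"
        using PiE_mem[OF a(1), of "i - 1"] by (auto simp: A'_def)
    next
      fix i j assume "1 \<le> i \<and> i < j \<and> j \<le> n"
      then obtain i' j' where ij: "i = Suc i'" "j = Suc j'" "i' < j'" "j' < n"
        by (cases i; cases j) auto
      show "a (i - 1) - a (j - 1) \<notin> S i j"
      proof
        assume "a (i - 1) - a (j - 1) \<in> S i j"
        then obtain s where "s < 2 * m - 1" "a i' - a j' = h i' j' s"
          using h[OF ij(3,4)] ij by auto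
        moreover from this have "Suc s < 2 * m"
          by linarith
        ultimately show False
          using factor[OF ij(3,4), of "Suc s"] by (auto simp: z_def algebra_simps)
      qed
      show "a (i - 1) * b (i - 1) * c i \<noteq> a (j - 1) * b (j - 1) * c j"
        using factor[OF ij(3,4), of 0] assms(2) ij by (auto simp: z_def y_def algebra_simps)
    qed
    moreover have "(\<Sum>i=1..n. a (i - 1)) = (\<Sum>i<n. a i)"
      by (rule sum.reindex_bij_witness[of _ Suc "\<lambda>i. i - 1"]) auto
    ultimately obtain u where "u < l * n" "(\<Sum>i<n. a i) = w u"
      using w by auto
    then show False
      using a(2) by auto
  qed
  moreover have "is_SDR n B (\<lambda>i. b (i - 1))"
    unfolding is_SDR_def
  proof (intro conjI ballI)
    fix i assume "i \<in> {1..n}"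
    then show "b (i - 1) \<in> B i"
      using b(1)[rule_format, of "i - 1"] by auto
  next
    show "inj_on (\<lambda>i. b (i - 1)) {1..n}"
    proof (rule inj_onI)
      fix i j assume ij: "i \<in> {1..n}" "j \<in> {1..n}" "b (i - 1) = b (j - 1)"
      then have "i - 1 = j - 1"
        by (intro inj_onD[OF b(2)]) auto
      then show "i = j"
        using ij by auto
    qed
  qed
  ultimately show ?thesis
    by (intro exI[of _ "\<lambda>i. b (i - 1)"]) (simp add: X_def l_def)
qed

end
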